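(* In the general network game with endogenous links described in the context, let $(\boldsymbol{\beta}^*,\boldsymbol{\sigma}^* )$ be an optimal subsidy such that (1) the equilibrium selection $(\boldsymbol{\beta},\boldsymbol{\sigma})\mapsto(\boldsymbol{a}^*(\boldsymbol{\beta},\boldsymbol{\sigma}),\boldsymbol{g}^*(\boldsymbol{\beta},\boldsymbol{\sigma}))$ is differentiable in a neighborhood of $(\boldsymbol{\beta}^*,\boldsymbol{\sigma}^* )$, and (2) the planner's budget constraint strictly binds at $(\boldsymbol{\beta}^*,\boldsymbol{\sigma}^* )$. Let $i\ne j$ be agents with $s_{ij}<0$. If (a) the link formation cost function $F_{ij}=F_{ji}$ is sub-quadratic, (b) the payoff functions $u_{ij}$ and $u_{ji}$ are super-linear, and (c) the optimal action subsidies satisfy $\beta_i^*,\beta_j^*>0$, and the selected equilibrium at $(\boldsymbol{\beta}^*,\boldsymbol{\sigma}^* )$ has link intensities $g_{ij}^*,g_{ji}^*>0$, then $\sigma_{ij}^*+\sigma_{ji}^*>0$.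
   Context: **Game.** There are $n$ agents $\mathcal{N}=\{1,\dots,n\}$. Simultaneously, each agent $i$ chooses an action $a_i\ge 0$ and link intensities $g_{ij}\ge 0$ for all $j\in\mathcal{N}\setminus\{i\}$. Link strengths are $G_{ij}=G_{ji}=g_{ij}+g_{ji}$ for $i\neq j$. Agent $i$'s utility without subsidies is $$U_i(\boldsymbol a,\boldsymbol g)=b_ia_i+\rho\sum_{j\ne i}G_{ij}u_{ij}(a_i)u_{ji}(a_j)-C_i(a_i)+\sum_{j\ne i}s_{ij}G_{ij}-\sum_{j\ne i}F_{ij}(g_{ij}),$$ where $b_i>0$; $\rho>0$; $s_{ij}=s_{ji}\in\mathbb R$; $C_i:\mathbb R_{\ge0}\to\mathbb R_{\ge0}$ is twice differentiable, strictly increasing and strictly convex with $C_i'(0)=0$; $F_{ij}=F_{ji}:\mathbb R_{\ge0}\to\mathbb R_{\ge0}$ is twice differentiable, strictly increasing and strictly convex with $F_{ij}'(0)=0$; $u_{ij}:\mathbb R_{\ge0}\to\mathbb R_{\ge0}$ is twice differentiable and strictly increasing with $u_{ij}(0)=0$. **Function classes.** $F$ is *sub-quadratic* if $GF''(G)\le F'(G)$ for all $G\ge0$. $u$ is *super-linear* if $u(a)\le a\,u'(a)$ for all $a\ge0$. **Subsidies.** A subsidy is $(\boldsymbol{\beta},\boldsymbol{\sigma})$ with $\beta_i\ge0$ and $\sigma_{ij}\ge0$ for ordered pairs $i\ne j$ (not necessarily symmetric). Under it agent $i$'s utility is $\mathcal{U}_i=U_i(\boldsymbol a,\boldsymbol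 g)+\beta_ia_i+\sum_{j\ne i}\sigma_{ij}G_{ij}$, and the planner pays $\mathcal{P}=\sum_i\beta_ia_i+\sum_i\sum_{j\ne i}\sigma_{ij}G_{ij}$. Agents play a pure strategy Nash equilibrium of the game with utilities $\mathcal U_i$. An equilibrium selection $(\boldsymbol{a}^*(\boldsymbol{\beta},\boldsymbol{\sigma}),\boldsymbol{g}^*(\boldsymbol{\beta},\boldsymbol{\sigma}))$ is fixed (it assigns a pure Nash equilibrium to each subsidy for which one exists; welfare is set to $-\infty$ where none exists). **Planner.** The objective $\mathcal{W}(\boldsymbol a)$ is differentiable and strictly increasing in each argument; the budget is $\mathcal{B}>0$. A subsidy is optimal if an equilibrium exists under it, $\mathcal{P}\le\mathcal{B}$ at the selected equilibrium, and it maximizes $\mathcal{W}(\boldsymbol{a}^*(\boldsymbol{\beta},\boldsymbol{\sigma}))$ among subsidies satisfying the budget constraint at the selected equilibrium. **Conventions.** Neighborhoods and derivatives in $(\boldsymbol\beta,\boldsymbol\sigma)$ are relative to the set of nonnegative subsidies (one-sided at the boundary). The budget constraint *strictly binds* at $(\boldsymbol{\beta}^*,\boldsymbol{\sigma}^* )$ if $\mathcal P=\mathcal B$ there and the Karush–Kuhn–Tucker first-order conditions hold there with a strictly positive multiplier: there is $\lambda>0$ such that, viewing $\mathcal{L}=\mathcal{W}-\lambda\mathcal{P}$ (evaluated at the selected equilibrium) as a function of $(\boldsymbol\beta,\boldsymbol\sigma)$, at $(\boldsymbol{\beta}^*,\boldsymbol{\sigma}^* )$ one has $\frac{d\mathcal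 L}{d\beta_k}\le0$ with equality if $\beta_k^*>0$, and $\frac{d\mathcal L}{d\sigma_{kl}}\le0$ with equality if $\sigma_{kl}^*>0$, for all $k$ and all $k\neq l$. *)

theory Defs
  imports "HOL-Analysis.Analysis"
begin

section \<open>Functions on the nonnegative reals\<close>

text \<open>A function from the nonnegative reals to themselves is represented by a total function of
  which only the values on \<open>{0..}\<close> matter; the derivative is therefore taken within \<open>{0..}\<close>,
  i.e. it is one-sided at \<open>0\<close>.\<close>

definition deriv_nn :: "(real \<Rightarrow> real) \<Rightarrow> real \<Rightarrow> real" where
  "deriv_nn f x = vector_derivative f (at x within {0..})"

definition twice_differentiable_nn :: "(real \<Rightarrow> real) \<Rightarrow> bool" where
  "twice_differentiable_nn f \<longleftrightarrow>
     f differentiable_on {0..} \<and> deriv_nn f differentiable_on {0..}"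

definition strictly_convex_nn :: "(real \<Rightarrow> real) \<Rightarrow> bool" where
  "strictly_convex_nn f \<longleftrightarrow>
     (\<forall>x\<ge>0. \<forall>y\<ge>0. \<forall>t. x \<noteq> y \<and> 0 < t \<and> t < 1 \<longrightarrow>
        f ((1 - t) * x + t * y) < (1 - t) * f x + t * f y)"

definition sub_quadratic :: "(real \<Rightarrow> real) \<Rightarrow> bool" where
  "sub_quadratic F \<longleftrightarrow> (\<forall>x\<ge>0. x * deriv_nn (deriv_nn F) x \<le> deriv_nn F x)"

definition super_linear :: "(real \<Rightarrow> real) \<Rightarrow> bool" where
  "super_linear u \<longleftrightarrow> (\<forall>x\<ge>0. u x \<le> x * deriv_nn u x)"

definition cost_function :: "(real \<Rightarrow> real) \<Rightarrow> bool" where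
  "cost_function f \<longleftrightarrow>
     f \<in> {0..} \<rightarrow> {0..} \<and> twice_differentiable_nn f \<and> strict_mono_on {0..} f \<and>
     strictly_convex_nn f \<and> deriv_nn f 0 = 0"

definition payoff_function :: "(real \<Rightarrow> real) \<Rightarrow> bool" where
  "payoff_function u \<longleftrightarrow>
     u \<in> {0..} \<rightarrow> {0..} \<and> twice_differentiable_nn u \<and> strict_mono_on {0..} u \<and> u 0 = 0"


section \<open>The game\<close>

text \<open>The fields are \<open>b\<close>, \<open>\<rho>\<close>, \<open>s\<close>, \<open>C\<close>, \<open>F\<close> and \<open>u\<close>. The agents are the elements of the finite
  type \<open>'n\<close>; fields with two agents as arguments are only meaningful for distinct agents.\<close>

record 'n network_game =
  benefit :: "'n \<Rightarrow> real"
  synergy :: real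
  link_value :: "'n \<Rightarrow> 'n \<Rightarrow> real"
  action_cost :: "'n \<Rightarrow> real \<Rightarrow> real"
  link_cost :: "'n \<Rightarrow> 'n \<Rightarrow> real \<Rightarrow> real"
  payoff :: "'n \<Rightarrow> 'n \<Rightarrow> real \<Rightarrow> real"

definition valid_game :: "'n::finite network_game \<Rightarrow> bool" where
  "valid_game \<Gamma> \<longleftrightarrow>
     synergy \<Gamma> > 0 \<and>
     (\<forall>i. benefit \<Gamma> i > 0 \<and> cost_function (action_cost \<Gamma> i)) \<and>
     (\<forall>i j. i \<noteq> j \<longrightarrow>
        link_value \<Gamma> i j = link_value \<Gamma> j i \<and>
        cost_function (link_cost \<Gamma> i j) \<and>
        (\<forall>x\<ge>0. link_cost \<Gamma> i j x = link_cost \<Gamma> j i x) \<and>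
        payoff_function (payoff \<Gamma> i j))"

text \<open>An action vector together with link intensities, and likewise action subsidies together with
  link subsidies, form an element of \<open>real^'n \<times> real^'n^'n\<close>. There are no self-links: the
  diagonal of the matrix, which has no counterpart in the model, is fixed to be \<open>0\<close>. Strategy
  profiles and subsidies thus range over the same set.\<close>

definition nonneg_pairs :: "((real^'n) \<times> (real^'n^'n)) set" where
  "nonneg_pairs =
     {(v, m). (\<forall>i. 0 \<le> v $ i) \<and> (\<forall>i j. 0 \<le> m $ i $ j) \<and> (\<forall>i. m $ i $ i = 0)}"

abbreviation subsidies :: "((real^'n) \<times> (real^'n^'n)) set" where
  "subsidies \<equiv> nonneg_pairs"

abbreviation profiles :: "((real^'n) \<times> (real^'n^'n)) set" where
  "profiles \<equiv> nonneg_pairs"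

definition link_strength :: "real^'n^'n \<Rightarrow> 'n \<Rightarrow> 'n \<Rightarrow> real" where
  "link_strength g i j = g $ i $ j + g $ j $ i"

definition utility ::
  "'n::finite network_game \<Rightarrow> 'n \<Rightarrow> (real^'n) \<times> (real^'n^'n) \<Rightarrow> real" where
  "utility \<Gamma> i = (\<lambda>(a, g).
     benefit \<Gamma> i * a $ i
     + synergy \<Gamma> * (\<Sum>j\<in>UNIV - {i}.
         link_strength g i j * payoff \<Gamma> i j (a $ i) * payoff \<Gamma> j i (a $ j))
     - action_cost \<Gamma> i (a $ i)
     + (\<Sum>j\<in>UNIV - {i}. link_value \<Gamma> i j * link_strength g i j)
     - (\<Sum>j\<in>UNIV - {i}. link_cost \<Gamma> i j (g $ i $ j)))"

definition subsidy_receipt ::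
  "(real^'n) \<times> (real^'n^'n) \<Rightarrow> 'n::finite \<Rightarrow> (real^'n) \<times> (real^'n^'n) \<Rightarrow> real" where
  "subsidy_receipt = (\<lambda>(\<beta>, \<sigma>) i (a, g).
     \<beta> $ i * a $ i + (\<Sum>j\<in>UNIV - {i}. \<sigma> $ i $ j * link_strength g i j))"

definition subsidized_utility ::
  "'n::finite network_game \<Rightarrow> (real^'n) \<times> (real^'n^'n) \<Rightarrow> 'n \<Rightarrow>
   (real^'n) \<times> (real^'n^'n) \<Rightarrow> real" where
  "subsidized_utility \<Gamma> x i p = utility \<Gamma> i p + subsidy_receipt x i p"

definition planner_payment ::
  "(real^'n) \<times> (real^'n^'n) \<Rightarrow> (real^'n::finite) \<times> (real^'n^'n) \<Rightarrow> real" where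
  "planner_payment x p = (\<Sum>i\<in>UNIV. subsidy_receipt x i p)"

definition upd :: "'a^'n \<Rightarrow> 'n \<Rightarrow> 'a \<Rightarrow> 'a^'n" where
  "upd v k t = (\<chi> m. if m = k then t else v $ m)"

definition nash_equilibrium ::
  "'n::finite network_game \<Rightarrow> (real^'n) \<times> (real^'n^'n) \<Rightarrow>
   (real^'n) \<times> (real^'n^'n) \<Rightarrow> bool" where
  "nash_equilibrium \<Gamma> x = (\<lambda>(a, g).
     (a, g) \<in> profiles \<and>
     (\<forall>i a' g'. (upd a i a', upd g i g') \<in> profiles \<longrightarrow>
        subsidized_utility \<Gamma> x i (upd a i a', upd g i g') \<le> subsidized_utility \<Gamma> x i (a, g)))"

definition has_equilibrium ::
  "'n::finite network_game \<Rightarrow> (real^'n) \<times> (real^'n^'n) \<Rightarrow> bool" where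
  "has_equilibrium \<Gamma> x \<longleftrightarrow> (\<exists>p. nash_equilibrium \<Gamma> x p)"

text \<open>A selection is a total function here; its values at subsidies without an equilibrium are
  arbitrary.\<close>

definition equilibrium_selection ::
  "'n::finite network_game \<Rightarrow>
   ((real^'n) \<times> (real^'n^'n) \<Rightarrow> (real^'n) \<times> (real^'n^'n)) \<Rightarrow> bool" where
  "equilibrium_selection \<Gamma> eq \<longleftrightarrow>
     (\<forall>x\<in>subsidies. has_equilibrium \<Gamma> x \<longrightarrow> nash_equilibrium \<Gamma> x (eq x))"

text \<open>Neighborhoods and derivatives are relative to the set of subsidies. The selection is defined
  only where equilibria exist, so differentiability on a neighborhood includes their existence
  there.\<close>

definition selection_differentiable_near ::
  "'n::finite network_game \<Rightarrow>
   ((real^'n) \<times> (real^'n^'n) \<Rightarrow> (real^'n) \<times> (real^'n^'n)) \<Rightarrow>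
   (real^'n) \<times> (real^'n^'n) \<Rightarrow> bool" where
  "selection_differentiable_near \<Gamma> eq x \<longleftrightarrow>
     (\<exists>N. open N \<and> x \<in> N \<and> (\<forall>y\<in>N \<inter> subsidies. has_equilibrium \<Gamma> y) \<and>
          eq differentiable_on (N \<inter> subsidies))"


section \<open>The planner\<close>

definition planner_objective :: "(real^'n::finite \<Rightarrow> real) \<Rightarrow> bool" where
  "planner_objective W \<longleftrightarrow>
     W differentiable_on {a. \<forall>i. 0 \<le> a $ i} \<and>
     (\<forall>a k t. (\<forall>i. 0 \<le> a $ i) \<and> a $ k < t \<longrightarrow> W a < W (upd a k t))"

text \<open>Since welfare is \<open>-\<infinity>\<close> where there is no equilibrium, the maximum is over the subsidies that
  have one.\<close>

definition optimal_subsidy ::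
  "'n::finite network_game \<Rightarrow> (real^'n \<Rightarrow> real) \<Rightarrow> real \<Rightarrow>
   ((real^'n) \<times> (real^'n^'n) \<Rightarrow> (real^'n) \<times> (real^'n^'n)) \<Rightarrow>
   (real^'n) \<times> (real^'n^'n) \<Rightarrow> bool" where
  "optimal_subsidy \<Gamma> W B eq x \<longleftrightarrow>
     x \<in> subsidies \<and> has_equilibrium \<Gamma> x \<and> planner_payment x (eq x) \<le> B \<and>
     (\<forall>y\<in>subsidies. has_equilibrium \<Gamma> y \<and> planner_payment y (eq y) \<le> B \<longrightarrow>
        W (fst (eq y)) \<le> W (fst (eq x)))"

definition lagrangian ::
  "(real^'n::finite \<Rightarrow> real) \<Rightarrow>
   ((real^'n) \<times> (real^'n^'n) \<Rightarrow> (real^'n) \<times> (real^'n^'n)) \<Rightarrow> real \<Rightarrow>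
   (real^'n) \<times> (real^'n^'n) \<Rightarrow> real" where
  "lagrangian W eq l x = W (fst (eq x)) - l * planner_payment x (eq x)"

text \<open>The partial derivatives are one-sided where the subsidy in question is \<open>0\<close>.\<close>

definition budget_strictly_binds ::
  "(real^'n::finite \<Rightarrow> real) \<Rightarrow> real \<Rightarrow>
   ((real^'n) \<times> (real^'n^'n) \<Rightarrow> (real^'n) \<times> (real^'n^'n)) \<Rightarrow>
   (real^'n) \<times> (real^'n^'n) \<Rightarrow> bool" where
  "budget_strictly_binds W B eq = (\<lambda>(\<beta>, \<sigma>).
     planner_payment (\<beta>, \<sigma>) (eq (\<beta>, \<sigma>)) = B \<and>
     (\<exists>l>0.
        (\<forall>k. \<exists>D.
           ((\<lambda>t. lagrangian W eq l (upd \<beta> k t, \<sigma>)) has_real_derivative D)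
             (at (\<beta> $ k) within {0..}) \<and>
           D \<le> 0 \<and> (\<beta> $ k > 0 \<longrightarrow> D = 0)) \<and>
        (\<forall>k m. k \<noteq> m \<longrightarrow> (\<exists>D.
           ((\<lambda>t. lagrangian W eq l (\<beta>, upd \<sigma> k (upd (\<sigma> $ k) m t))) has_real_derivative D)
             (at (\<sigma> $ k $ m) within {0..}) \<and>
           D \<le> 0 \<and> (\<sigma> $ k $ m > 0 \<longrightarrow> D = 0)))))"

end

theory Submission
  imports Defs
begin

text \<open>Suppose \<open>\<sigma>\<^sub>i\<^sub>j = \<sigma>\<^sub>j\<^sub>i = 0\<close>, and move the equilibrium in the direction \<open>w\<close> that keeps all actions
  fixed, raises \<open>g\<^sub>i\<^sub>j\<close> at rate \<open>g\<^sub>i\<^sub>j\<close> and \<open>g\<^sub>j\<^sub>i\<close> at rate \<open>g\<^sub>j\<^sub>i\<close>. By the first-order conditions this needs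
  link subsidies rising at rate \<open>g F''(g) \<le> F'(g) = \<rho> u\<^sub>i\<^sub>j u\<^sub>j\<^sub>i + s\<^sub>i\<^sub>j\<close>, while super-linearity makes the action
  subsidies paid to \<open>i\<close> and to \<open>j\<close> each fall by at least \<open>\<rho> G\<^sub>i\<^sub>j u\<^sub>i\<^sub>j u\<^sub>j\<^sub>i\<close>. Payments thus change by at most
  \<open>2 G\<^sub>i\<^sub>j s\<^sub>i\<^sub>j < 0\<close> at unchanged welfare, which contradicts the Karush-Kuhn-Tucker conditions.

  It remains to see that the derivative \<open>D\<close> of the selection attains \<open>w\<close>. A zero link need not satisfy its
  first-order condition with equality nearby, but differentiability forces a dichotomy: either the
  linearised condition holds along all nonnegative directions, or the link stays zero to first order.
  On the space \<open>S\<close> of subsidies supported on the links of the first kind, \<open>D\<close> is therefore an endomorphism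
  whose argument can be recovered from its value, hence injective and, by dimension, onto.\<close>

section \<open>One-sided calculus on the nonnegative reals\<close>

lemma has_deriv_nn:
  assumes "f differentiable_on {0..}" "0 \<le> x"
  shows "(f has_real_derivative deriv_nn f x) (at x within {0..})"
  using assms unfolding deriv_nn_def differentiable_on_def
  by (simp add: has_real_derivative_iff_has_vector_derivative vector_derivative_works)

lemma mono_deriv_nn_nonneg:
  assumes "f differentiable_on {0..}" "mono_on {0..} f" "0 \<le> x"
  shows "0 \<le> deriv_nn f x"
proof -
  have "(f has_real_derivative deriv_nn f x) (at_right x)"
    by (rule has_field_derivative_subset[OF has_deriv_nn[OF assms(1,3)]]) (use assms(3) in auto)
  then have lim: "((\<lambda>y. (f y - f x) / (y - x)) \<longlongrightarrow> deriv_nn f x) (at_right x)"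
    by (simp add: has_field_derivative_iff)
  have "\<forall>\<^sub>F y in at_right x. 0 \<le> (f y - f x) / (y - x)"
    unfolding eventually_at_filter using assms(2,3) by (auto simp: mono_on_def)
  then show ?thesis
    using tendsto_lowerbound[OF lim] by simp
qed

text \<open>Difference quotients to the right of a maximum are nonpositive; at an interior point the
  derivative is two-sided and Fermat's rule gives equality.\<close>

lemma deriv_at_max_nn:
  assumes d: "(f has_real_derivative D) (at x within {0..})" and x: "0 \<le> x"
    and max: "\<And>y. 0 \<le> y \<Longrightarrow> f y \<le> f x"
  shows "D \<le> 0" "0 < x \<Longrightarrow> D = 0"
proof -
  have "(f has_real_derivative D) (at x within {x<..})"
    by (rule has_field_derivative_subset[OF d]) (use x in auto)
  then have lim: "((\<lambda>y. (f y - f x) / (y - x)) \<longlongrightarrow> D) (at_right x)"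
    by (simp add: has_field_derivative_iff)
  have "\<forall>\<^sub>F y in at_right x. (f y - f x) / (y - x) \<le> 0"
    unfolding eventually_at_filter using x max
    by (auto simp: divide_nonpos_pos)
  then show "D \<le> 0"
    using tendsto_upperbound[OF lim] by simp
  assume "0 < x"
  have "(f has_real_derivative D) (at x within {0<..})"
    by (rule has_field_derivative_subset[OF d]) auto
  then have "DERIV f x :> D"
    using \<open>0 < x\<close> by (simp add: at_within_open[of x "{0<..}"])
  then show "D = 0"
    by (rule DERIV_local_max[where d = x]) (use \<open>0 < x\<close> max in auto)
qed

lemma strictly_convex_nn_imp_convex_on:
  assumes "strictly_convex_nn f"
  shows "convex_on {0..} f"
proof (rule convex_onI)
  fix t x y :: real
  assume "0 < t" "t < 1" "x \<in> {0..}" "y \<in> {0..}"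
  then have "x \<noteq> y \<Longrightarrow> f ((1 - t) * x + t * y) < (1 - t) * f x + t * f y"
    using assms unfolding strictly_convex_nn_def by simp
  then show "f ((1 - t) *\<^sub>R x + t *\<^sub>R y) \<le> (1 - t) * f x + t * f y"
    by (cases "x = y") (simp_all flip: distrib_right)
qed (simp add: convex_real_interval)

text \<open>Adding the tangent inequalities at two positive points shows that the derivative is
  monotone, so its right difference quotients have a nonnegative limit.\<close>

lemma convex_deriv_nn_deriv_nn_nonneg:
  assumes conv: "convex_on {0..} f" and d: "twice_differentiable_nn f" and x: "0 < x"
  shows "0 \<le> deriv_nn (deriv_nn f) x"
proof -
  have tangent: "deriv_nn f c * (y - c) \<le> f y - f c" if "0 < c" "0 \<le> y" for c y
    by (rule convex_on_imp_above_tangent[OF conv _ _ _ has_deriv_nn])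
      (use d that in \<open>auto simp: twice_differentiable_nn_def\<close>)
  have mono: "deriv_nn f y \<le> deriv_nn f z" if "0 < y" "y < z" for y z
  proof -
    have "0 \<le> (deriv_nn f z - deriv_nn f y) * (z - y)"
      using tangent[of y z] tangent[of z y] that by (simp add: algebra_simps)
    then show ?thesis using that by (simp add: zero_le_mult_iff)
  qed
  have "(deriv_nn f has_real_derivative deriv_nn (deriv_nn f) x) (at x within {0..})"
    by (rule has_deriv_nn) (use d x in \<open>auto simp: twice_differentiable_nn_def\<close>)
  then have "(deriv_nn f has_real_derivative deriv_nn (deriv_nn f) x) (at_right x)"
    by (rule has_field_derivative_subset) (use x in auto)
  then have lim: "((\<lambda>y. (deriv_nn f y - deriv_nn f x) / (y - x)) \<longlongrightarrow> deriv_nn (deriv_nn f) x) (at_right x)"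
    by (simp add: has_field_derivative_iff)
  have "\<forall>\<^sub>F y in at_right x. 0 \<le> (deriv_nn f y - deriv_nn f x) / (y - x)"
    unfolding eventually_at_filter using x mono by auto
  then show ?thesis
    using tendsto_lowerbound[OF lim] by simp
qed

section \<open>First-order conditions\<close>

lemma upd_nth [simp]: "upd v k t $ m = (if m = k then t else v $ m)"
  by (simp add: upd_def)

lemma upd_same [simp]: "upd v k (v $ k) = v"
  by (simp add: vec_eq_iff)

lemma cost_functionD:
  assumes "cost_function f"
  shows "f differentiable_on {0..}" "deriv_nn f differentiable_on {0..}" "mono_on {0..} f"
    "deriv_nn f 0 = 0" "0 \<le> x \<Longrightarrow> 0 \<le> deriv_nn f x" "0 < x \<Longrightarrow> 0 \<le> deriv_nn (deriv_nn f) x"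
proof -
  show *: "f differentiable_on {0..}" "deriv_nn f differentiable_on {0..}" "mono_on {0..} f"
    "deriv_nn f 0 = 0"
    using assms by (auto simp: cost_function_def twice_differentiable_nn_def strict_mono_on_imp_mono_on)
  show "0 \<le> x \<Longrightarrow> 0 \<le> deriv_nn f x" using * by (simp add: mono_deriv_nn_nonneg)
  show "0 < x \<Longrightarrow> 0 \<le> deriv_nn (deriv_nn f) x"
    using assms
    by (simp add: cost_function_def convex_deriv_nn_deriv_nn_nonneg strictly_convex_nn_imp_convex_on)
qed

lemma payoff_functionD:
  assumes "payoff_function u"
  shows "u differentiable_on {0..}" "deriv_nn u differentiable_on {0..}"
    "0 \<le> x \<Longrightarrow> 0 \<le> u x" "0 \<le> x \<Longrightarrow> 0 \<le> deriv_nn u x"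
proof -
  show *: "u differentiable_on {0..}" "deriv_nn u differentiable_on {0..}" "0 \<le> x \<Longrightarrow> 0 \<le> u x"
    using assms by (auto simp: payoff_function_def twice_differentiable_nn_def)
  have "mono_on {0..} u"
    using assms by (simp add: payoff_function_def strict_mono_on_imp_mono_on)
  with * show "0 \<le> x \<Longrightarrow> 0 \<le> deriv_nn u x"
    by (simp add: mono_deriv_nn_nonneg)
qed

text \<open>The value of \<open>\<beta> $ k\<close> that turns agent \<open>k\<close>'s first-order
  condition for the action into an equality at \<open>(a, g)\<close>.\<close>

definition implied_action_subsidy ::
  "'n::finite network_game \<Rightarrow> 'n \<Rightarrow> (real^'n) \<times> (real^'n^'n) \<Rightarrow> real" where
  "implied_action_subsidy \<Gamma> k = (\<lambda>(a, g).
     deriv_nn (action_cost \<Gamma> k) (a $ k) - benefit \<Gamma> k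
     - synergy \<Gamma> * (\<Sum>l\<in>UNIV - {k}.
         link_strength g k l * deriv_nn (payoff \<Gamma> k l) (a $ k) * payoff \<Gamma> l k (a $ l)))"

text \<open>The marginal benefit to \<open>k\<close> of the intensity \<open>g $ k $ l\<close>,
  before link cost and subsidy. Apart from link costs utility is affine in the links, so only
  actions enter.\<close>

definition link_return ::
  "'n network_game \<Rightarrow> 'n \<Rightarrow> 'n \<Rightarrow> real^'n \<Rightarrow> real" where
  "link_return \<Gamma> k l a =
     synergy \<Gamma> * (payoff \<Gamma> k l (a $ k) * payoff \<Gamma> l k (a $ l)) + link_value \<Gamma> k l"

text \<open>At action \<open>0\<close> the marginal cost vanishes, the benefit is positive and the
  synergy and subsidy terms are nonnegative. The corner is therefore not optimal, and the
  first-order condition is an equality.\<close>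

lemma nash_action:
  fixes \<Gamma> :: "'n::finite network_game" and a \<beta> :: "real^'n" and g \<sigma> :: "real^'n^'n"
  assumes valid: "valid_game \<Gamma>" and nash: "nash_equilibrium \<Gamma> (\<beta>, \<sigma>) (a, g)"
    and \<beta>: "0 \<le> \<beta> $ k"
  shows "0 < a $ k" "implied_action_subsidy \<Gamma> k (a, g) = \<beta> $ k"
proof -
  let ?f = "\<lambda>t. subsidized_utility \<Gamma> (\<beta>, \<sigma>) k (upd a k t, g)"
  let ?S = "\<lambda>t. \<Sum>l\<in>UNIV - {k}.
    link_strength g k l * deriv_nn (payoff \<Gamma> k l) t * payoff \<Gamma> l k (a $ l)"
  have prof: "(a, g) \<in> profiles" using nash by (simp add: nash_equilibrium_def)
  then have nn: "0 \<le> a $ l" "0 \<le> g $ l $ m" for l m by (auto simp: nonneg_pairs_def)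
  have C: "cost_function (action_cost \<Gamma> k)" and b: "0 < benefit \<Gamma> k" and \<rho>: "0 < synergy \<Gamma>"
    and u: "\<And>l m. l \<noteq> m \<Longrightarrow> payoff_function (payoff \<Gamma> l m)"
    using valid by (auto simp: valid_game_def)
  have max: "?f t \<le> ?f (a $ k)" if "0 \<le> t" for t
  proof -
    have "(upd a k t, upd g k (g $ k)) \<in> profiles"
      using prof that by (auto simp: nonneg_pairs_def)
    then show ?thesis using nash unfolding nash_equilibrium_def by fastforce
  qed
  have f: "?f = (\<lambda>t. (benefit \<Gamma> k * t
     + synergy \<Gamma> * (\<Sum>l\<in>UNIV - {k}.
         link_strength g k l * payoff \<Gamma> k l t * payoff \<Gamma> l k (a $ l))
     - action_cost \<Gamma> k t
     + (\<Sum>l\<in>UNIV - {k}. link_value \<Gamma> k l * link_strength g k l)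
     - (\<Sum>l\<in>UNIV - {k}. link_cost \<Gamma> k l (g $ k $ l)))
     + (\<beta> $ k * t + (\<Sum>l\<in>UNIV - {k}. \<sigma> $ k $ l * link_strength g k l)))"
    by (auto simp: subsidized_utility_def utility_def subsidy_receipt_def intro!: sum.cong)
  have S: "((\<lambda>t. \<Sum>l\<in>UNIV - {k}. link_strength g k l * payoff \<Gamma> k l t * payoff \<Gamma> l k (a $ l))
      has_real_derivative ?S (a $ k)) (at (a $ k) within {0..})"
    by (rule DERIV_sum, rule DERIV_cmult_right, rule DERIV_cmult, rule has_deriv_nn[OF payoff_functionD(1)[OF u]])
      (use nn in auto)
  have C': "(action_cost \<Gamma> k has_real_derivative deriv_nn (action_cost \<Gamma> k) (a $ k)) (at (a $ k) within {0..})"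
    by (rule has_deriv_nn[OF cost_functionD(1)[OF C] nn(1)])
  have "(?f has_real_derivative
      benefit \<Gamma> k + synergy \<Gamma> * ?S (a $ k) - deriv_nn (action_cost \<Gamma> k) (a $ k) + \<beta> $ k)
      (at (a $ k) within {0..})"
    unfolding f by (rule derivative_eq_intros S C' refl)+ simp
  from deriv_at_max_nn[OF this nn(1) max]
  have *: "benefit \<Gamma> k + synergy \<Gamma> * ?S (a $ k) - deriv_nn (action_cost \<Gamma> k) (a $ k) + \<beta> $ k \<le> 0"
    "0 < a $ k \<Longrightarrow>
     benefit \<Gamma> k + synergy \<Gamma> * ?S (a $ k) - deriv_nn (action_cost \<Gamma> k) (a $ k) + \<beta> $ k = 0"
    by auto
  have "0 \<le> ?S (a $ k)"
    by (intro sum_nonneg mult_nonneg_nonneg payoff_functionD[OF u])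
      (use nn in \<open>auto simp: link_strength_def\<close>)
  then have "0 \<le> synergy \<Gamma> * ?S (a $ k)" using \<rho> by simp
  then show "0 < a $ k"
    using * b \<beta> nn(1)[of k] cost_functionD(4)[OF C] by (cases "a $ k = 0") auto
  then show "implied_action_subsidy \<Gamma> k (a, g) = \<beta> $ k"
    using *(2) by (simp add: implied_action_subsidy_def)
qed

text \<open>Marginal link cost is nonnegative and vanishes at intensity \<open>0\<close>, so
  complementary slackness fits into one equation with \<open>max\<close>. It holds at zero and
  positive links alike and can be differentiated along a path on which a link switches between the
  two.\<close>

lemma nash_link:
  fixes \<Gamma> :: "'n::finite network_game" and a \<beta> :: "real^'n" and g \<sigma> :: "real^'n^'n"
  assumes valid: "valid_game \<Gamma>" and nash: "nash_equilibrium \<Gamma> (\<beta>, \<sigma>) (a, g)"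
    and kl: "k \<noteq> l"
  shows "deriv_nn (link_cost \<Gamma> k l) (g $ k $ l) = max 0 (link_return \<Gamma> k l a + \<sigma> $ k $ l)"
    "link_return \<Gamma> k l a + \<sigma> $ k $ l < 0 \<Longrightarrow> g $ k $ l = 0"
    "0 < g $ k $ l \<Longrightarrow> deriv_nn (link_cost \<Gamma> k l) (g $ k $ l) = link_return \<Gamma> k l a + \<sigma> $ k $ l"
proof -
  let ?f = "\<lambda>t. subsidized_utility \<Gamma> (\<beta>, \<sigma>) k (a, upd g k (upd (g $ k) l t))"
  let ?h = "link_return \<Gamma> k l a + \<sigma> $ k $ l"
  let ?F' = "deriv_nn (link_cost \<Gamma> k l) (g $ k $ l)"
  let ?G = "\<lambda>t m. (if m = l then t else g $ k $ m) + g $ m $ k"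
  have prof: "(a, g) \<in> profiles" using nash by (simp add: nash_equilibrium_def)
  then have nn: "0 \<le> g $ l $ m" for l m by (auto simp: nonneg_pairs_def)
  have F: "cost_function (link_cost \<Gamma> k l)"
    using valid kl by (auto simp: valid_game_def)
  have max: "?f t \<le> ?f (g $ k $ l)" if "0 \<le> t" for t
  proof -
    have "(upd a k (a $ k), upd g k (upd (g $ k) l t)) \<in> profiles"
      using prof that kl by (auto simp: nonneg_pairs_def)
    then show ?thesis using nash unfolding nash_equilibrium_def by fastforce
  qed
  have f: "?f = (\<lambda>t. (benefit \<Gamma> k * a $ k
     + synergy \<Gamma> * (\<Sum>m\<in>UNIV - {k}. ?G t m * (payoff \<Gamma> k m (a $ k) * payoff \<Gamma> m k (a $ m)))
     - action_cost \<Gamma> k (a $ k)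
     + (\<Sum>m\<in>UNIV - {k}. link_value \<Gamma> k m * ?G t m)
     - (\<Sum>m\<in>UNIV - {k}. link_cost \<Gamma> k m (if m = l then t else g $ k $ m)))
     + (\<beta> $ k * a $ k + (\<Sum>m\<in>UNIV - {k}. \<sigma> $ k $ m * ?G t m)))"
    by (auto simp: subsidized_utility_def utility_def subsidy_receipt_def link_strength_def
        mult.assoc intro!: sum.cong)
  have G: "((\<lambda>t. ?G t m) has_real_derivative (if m = l then 1 else 0)) (at t within A)" for m t A
    by (auto intro!: derivative_eq_intros)
  have Fd: "((\<lambda>t. link_cost \<Gamma> k m (if m = l then t else c)) has_real_derivative
      (if m = l then ?F' else 0)) (at (g $ k $ l) within {0..})" for m c
    using has_deriv_nn[OF cost_functionD(1)[OF F] nn] by auto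
  have S: "((\<lambda>t. \<Sum>m\<in>UNIV - {k}. ?G t m * (payoff \<Gamma> k m (a $ k) * payoff \<Gamma> m k (a $ m))) has_real_derivative
      (\<Sum>m\<in>UNIV - {k}. (if m = l then 1 else 0) * (payoff \<Gamma> k m (a $ k) * payoff \<Gamma> m k (a $ m))))
      (at t within A)"
    "((\<lambda>t. \<Sum>m\<in>UNIV - {k}. c m * ?G t m) has_real_derivative
      (\<Sum>m\<in>UNIV - {k}. c m * (if m = l then 1 else 0))) (at t within A)" for t A c
    by (intro DERIV_sum DERIV_cmult_right DERIV_cmult G)+
  have Fs: "((\<lambda>t. \<Sum>m\<in>UNIV - {k}. link_cost \<Gamma> k m (if m = l then t else g $ k $ m)) has_real_derivative
      (\<Sum>m\<in>UNIV - {k}. if m = l then ?F' else 0)) (at (g $ k $ l) within {0..})"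
    by (intro DERIV_sum Fd)
  have "(?f has_real_derivative
      synergy \<Gamma> * (\<Sum>m\<in>UNIV - {k}. (if m = l then 1 else 0) * (payoff \<Gamma> k m (a $ k) * payoff \<Gamma> m k (a $ m)))
     + (\<Sum>m\<in>UNIV - {k}. link_value \<Gamma> k m * (if m = l then 1 else 0))
     - (\<Sum>m\<in>UNIV - {k}. if m = l then ?F' else 0)
     + (\<Sum>m\<in>UNIV - {k}. \<sigma> $ k $ m * (if m = l then 1 else 0))) (at (g $ k $ l) within {0..})"
    unfolding f
    by (rule derivative_eq_intros S Fs refl)+ simp
  moreover have "synergy \<Gamma> * (\<Sum>m\<in>UNIV - {k}. (if m = l then 1 else 0) * (payoff \<Gamma> k m (a $ k) * payoff \<Gamma> m k (a $ m)))
     + (\<Sum>m\<in>UNIV - {k}. link_value \<Gamma> k m * (if m = l then 1 else 0))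
     - (\<Sum>m\<in>UNIV - {k}. if m = l then ?F' else 0)
     + (\<Sum>m\<in>UNIV - {k}. \<sigma> $ k $ m * (if m = l then 1 else 0)) = ?h - ?F'"
    using kl by (simp add: if_distrib[of "\<lambda>x. x * _"] if_distrib[of "\<lambda>x. _ * x"] sum.delta
        link_return_def cong: if_cong)
  ultimately have "(?f has_real_derivative ?h - ?F') (at (g $ k $ l) within {0..})" by simp
  from deriv_at_max_nn[OF this nn max]
  have *: "?h - ?F' \<le> 0" "0 < g $ k $ l \<Longrightarrow> ?h - ?F' = 0" by auto
  have F': "0 \<le> ?F'" "g $ k $ l = 0 \<Longrightarrow> ?F' = 0"
    using cost_functionD(4,5)[OF F] nn by auto
  then show "?F' = max 0 ?h" "?h < 0 \<Longrightarrow> g $ k $ l = 0" "0 < g $ k $ l \<Longrightarrow> ?F' = ?h"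
    using * nn[of k l] by (auto simp: less_eq_real_def max_def)
qed

section \<open>Differentiating the first-order conditions\<close>

text \<open>Allows differentiating an identity known only at \<open>x\<close> and just to its
  right.\<close>

lemma right_derivative_unique:
  fixes f g :: "real \<Rightarrow> real"
  assumes "(f has_real_derivative d) (at_right x)" "(g has_real_derivative e) (at_right x)"
    and "\<forall>\<^sub>F t in at_right x. f t = g t" "f x = g x"
  shows "d = e"
proof -
  have "((\<lambda>t. (f t - f x) / (t - x)) \<longlongrightarrow> e) (at_right x)"
    using assms(2)
    by (rule tendsto_cong[THEN iffD2, rotated, OF has_field_derivative_iff[THEN iffD1]])
      (use assms(3,4) in \<open>auto elim: eventually_mono\<close>)
  moreover have "((\<lambda>t. (f t - f x) / (t - x)) \<longlongrightarrow> d) (at_right x)"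
    using assms(1) by (simp add: has_field_derivative_iff)
  ultimately show ?thesis
    using tendsto_unique[OF trivial_limit_at_right_real] by blast
qed

text \<open>\<open>max 0\<close> is positively homogeneous, hence commutes with division by
  \<open>t - x > 0\<close>, and it is continuous.\<close>

lemma right_derivative_max_0:
  fixes h :: "real \<Rightarrow> real"
  assumes "(h has_real_derivative d) (at_right x)" "h x = 0"
  shows "((\<lambda>t. max 0 (h t)) has_real_derivative max 0 d) (at_right x)"
proof -
  have "((\<lambda>t. h t / (t - x)) \<longlongrightarrow> d) (at_right x)"
    using assms by (simp add: has_field_derivative_iff)
  then have "((\<lambda>t. max 0 (h t / (t - x))) \<longlongrightarrow> max 0 d) (at_right x)"
    by (intro tendsto_max tendsto_const)
  moreover have "\<forall>\<^sub>F t in at_right x. max 0 (h t / (t - x)) = max 0 (h t) / (t - x)"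
    unfolding eventually_at_filter by (auto simp: max_def zero_le_divide_iff divide_le_0_iff)
  ultimately show ?thesis
    using assms(2) by (simp add: has_field_derivative_iff tendsto_cong)
qed

lemma right_derivative_neg_eventually:
  fixes h :: "real \<Rightarrow> real"
  assumes "(h has_real_derivative d) (at_right x)" "h x \<le> 0" "h x = 0 \<Longrightarrow> d < 0"
  shows "\<forall>\<^sub>F t in at_right x. h t < 0"
proof (cases "h x = 0")
  case True
  have "((\<lambda>t. h t / (t - x)) \<longlongrightarrow> d) (at_right x)"
    using assms(1) True by (simp add: has_field_derivative_iff)
  from order_tendstoD(2)[OF this, of 0] assms(3) True
  have "\<forall>\<^sub>F t in at_right x. h t / (t - x) < 0" by simp
  moreover have "\<forall>\<^sub>F t in at_right x. x < t"
    by (simp add: eventually_at_filter)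
  ultimately show ?thesis
    by eventually_elim (simp add: divide_less_0_iff)
next
  case False
  have "continuous (at_right x) h"
    using assms(1) by (rule DERIV_continuous)
  then have "(h \<longlongrightarrow> h x) (at_right x)"
    by (simp add: continuous_within)
  then show ?thesis
    by (rule order_tendstoD(2)) (use assms(2) False in simp)
qed

lemma deriv_nn_chain:
  assumes "f differentiable_on {0..}" "(h has_real_derivative d) (at x within T)"
    and "\<And>t. t \<in> T \<Longrightarrow> 0 \<le> h t" "x \<in> T"
  shows "((\<lambda>t. f (h t)) has_real_derivative deriv_nn f (h x) * d) (at x within T)"
proof -
  have "(f has_real_derivative deriv_nn f (h x)) (at (h x) within h ` T)"
    by (rule has_field_derivative_subset[OF has_deriv_nn]) (use assms in auto)
  from DERIV_image_chain[OF this assms(2)] show ?thesis by (simp add: o_def)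
qed

text \<open>The formal differential of \<open>implied_action_subsidy\<close> at the first pair in
  the direction of the second, written out so that it is visibly linear in the direction.\<close>

definition implied_action_subsidy_deriv ::
  "'n::finite network_game \<Rightarrow> 'n \<Rightarrow> (real^'n) \<times> (real^'n^'n) \<Rightarrow> (real^'n) \<times> (real^'n^'n) \<Rightarrow> real" where
  "implied_action_subsidy_deriv \<Gamma> k = (\<lambda>(a, g) (a', g').
     deriv_nn (deriv_nn (action_cost \<Gamma> k)) (a $ k) * a' $ k
     - synergy \<Gamma> * (\<Sum>l\<in>UNIV - {k}.
         link_strength g' k l * deriv_nn (payoff \<Gamma> k l) (a $ k) * payoff \<Gamma> l k (a $ l)
         + link_strength g k l *
           (deriv_nn (deriv_nn (payoff \<Gamma> k l)) (a $ k) * a' $ k * payoff \<Gamma> l k (a $ l)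
            + deriv_nn (payoff \<Gamma> k l) (a $ k) * (deriv_nn (payoff \<Gamma> l k) (a $ l) * a' $ l))))"

definition link_return_deriv ::
  "'n network_game \<Rightarrow> 'n \<Rightarrow> 'n \<Rightarrow> real^'n \<Rightarrow> real^'n \<Rightarrow> real" where
  "link_return_deriv \<Gamma> k l a a' =
     synergy \<Gamma> * (deriv_nn (payoff \<Gamma> k l) (a $ k) * a' $ k * payoff \<Gamma> l k (a $ l)
       + payoff \<Gamma> k l (a $ k) * (deriv_nn (payoff \<Gamma> l k) (a $ l) * a' $ l))"

lemma linear_implied_action_subsidy_deriv: "linear (implied_action_subsidy_deriv \<Gamma> k p)"
  by (cases p; rule linearI)
    (auto simp: implied_action_subsidy_deriv_def link_strength_def algebra_simps sum.distrib
      sum_distrib_left sum_subtractf)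

lemma linear_link_return_deriv: "linear (link_return_deriv \<Gamma> k l a)"
  by (rule linearI) (auto simp: link_return_deriv_def algebra_simps)

text \<open>By the product rule, bilinearity splits a change of the payment into the cost of new
  subsidies at the old profile and the effect of the response on existing subsidies.\<close>

lemma bounded_bilinear_planner_payment:
  "bounded_bilinear (planner_payment :: (real^'n::finite) \<times> (real^'n^'n) \<Rightarrow> _)"
  unfolding bilinear_conv_bounded_bilinear[symmetric] bilinear_def
  by (intro conjI allI linearI)
    (auto simp: planner_payment_def subsidy_receipt_def link_strength_def algebra_simps
      sum.distrib sum_distrib_left)

lemma add_scaleR_nonneg_pairs:
  assumes "x \<in> nonneg_pairs" "v \<in> nonneg_pairs" "0 \<le> t"
  shows "x + t *\<^sub>R v \<in> nonneg_pairs"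
  using assms by (auto simp: nonneg_pairs_def)

text \<open>Equilibria along a ray of subsidies issuing from \<open>x\<close>. A nonnegative
  direction \<open>v\<close> keeps the ray inside the cone, so derivatives relative to the cone
  become right derivatives at \<open>0\<close>.\<close>

locale equilibrium_path =
  fixes \<Gamma> :: "'n::finite network_game" and x v w :: "(real^'n) \<times> (real^'n^'n)"
    and p :: "real \<Rightarrow> (real^'n) \<times> (real^'n^'n)" and \<delta> :: real
  assumes valid: "valid_game \<Gamma>"
    and \<delta>: "0 < \<delta>"
    and x: "x \<in> subsidies" and v: "v \<in> nonneg_pairs"
    and nash: "t \<in> {0..\<delta>} \<Longrightarrow> nash_equilibrium \<Gamma> (x + t *\<^sub>R v) (p t)"
    and p: "(p has_vector_derivative w) (at 0 within {0..\<delta>})"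
begin

lemma p_profile: "t \<in> {0..\<delta>} \<Longrightarrow> p t \<in> profiles"
  using nash[of t] by (auto simp: nash_equilibrium_def case_prod_unfold)

lemma p_nonneg: "t \<in> {0..\<delta>} \<Longrightarrow> 0 \<le> fst (p t) $ k" "t \<in> {0..\<delta>} \<Longrightarrow> 0 \<le> snd (p t) $ k $ l"
  using p_profile[of t] by (auto simp: nonneg_pairs_def)

lemma action_deriv: "((\<lambda>t. fst (p t) $ k) has_real_derivative fst w $ k) (at 0 within {0..\<delta>})"
  unfolding has_real_derivative_iff_has_vector_derivative
  by (rule bounded_linear.has_vector_derivative[OF _ p])
    (intro bounded_linear_compose[OF bounded_linear_vec_nth bounded_linear_fst])

lemma link_deriv: "((\<lambda>t. snd (p t) $ k $ l) has_real_derivative snd w $ k $ l) (at 0 within {0..\<delta>})"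
  unfolding has_real_derivative_iff_has_vector_derivative
  by (rule bounded_linear.has_vector_derivative[OF _ p])
    (intro bounded_linear_compose[OF bounded_linear_vec_nth]
      bounded_linear_compose[OF bounded_linear_vec_nth bounded_linear_snd])

lemma at_0: "at 0 within {0..\<delta>} = at_right 0"
  using \<delta> by (rule at_within_Icc_at_right)

lemma eventually_in: "\<forall>\<^sub>F t in at_right 0. t \<in> {0..\<delta>}"
  unfolding at_0[symmetric] by (simp add: eventually_at_filter)

lemma payoffs:
  assumes "k \<noteq> l"
  shows "((\<lambda>t. payoff \<Gamma> k l (fst (p t) $ k)) has_real_derivative
      deriv_nn (payoff \<Gamma> k l) (fst (p 0) $ k) * fst w $ k) (at 0 within {0..\<delta>})"
    "((\<lambda>t. deriv_nn (payoff \<Gamma> k l) (fst (p t) $ k)) has_real_derivative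
      deriv_nn (deriv_nn (payoff \<Gamma> k l)) (fst (p 0) $ k) * fst w $ k) (at 0 within {0..\<delta>})"
  using valid assms \<delta>
  by (auto intro!: deriv_nn_chain action_deriv p_nonneg simp: valid_game_def payoff_functionD)

text \<open>Every equilibrium on the path satisfies its action condition with equality, so both
  sides have the same right derivative.\<close>

lemma action_subsidy_direction: "fst v $ k = implied_action_subsidy_deriv \<Gamma> k (p 0) w"
proof (rule right_derivative_unique)
  show "((\<lambda>t. fst (x + t *\<^sub>R v) $ k) has_real_derivative fst v $ k) (at_right 0)"
    by (auto intro!: derivative_eq_intros)
  have C: "((\<lambda>t. deriv_nn (action_cost \<Gamma> k) (fst (p t) $ k)) has_real_derivative
      deriv_nn (deriv_nn (action_cost \<Gamma> k)) (fst (p 0) $ k) * fst w $ k) (at 0 within {0..\<delta>})"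
    by (rule deriv_nn_chain[OF _ action_deriv p_nonneg(1)])
      (use valid \<delta> in \<open>auto simp: valid_game_def cost_functionD\<close>)
  have G: "((\<lambda>t. link_strength (snd (p t)) k l) has_real_derivative link_strength (snd w) k l)
      (at 0 within {0..\<delta>})" for l
    unfolding link_strength_def by (intro DERIV_add link_deriv)
  have "((\<lambda>t. \<Sum>l\<in>UNIV - {k}. link_strength (snd (p t)) k l * deriv_nn (payoff \<Gamma> k l) (fst (p t) $ k) *
         payoff \<Gamma> l k (fst (p t) $ l)) has_real_derivative
     (\<Sum>l\<in>UNIV - {k}.
         link_strength (snd w) k l * deriv_nn (payoff \<Gamma> k l) (fst (p 0) $ k) * payoff \<Gamma> l k (fst (p 0) $ l)
         + link_strength (snd (p 0)) k l *
           (deriv_nn (deriv_nn (payoff \<Gamma> k l)) (fst (p 0) $ k) * fst w $ k * payoff \<Gamma> l k (fst (p 0) $ l)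
            + deriv_nn (payoff \<Gamma> k l) (fst (p 0) $ k) * (deriv_nn (payoff \<Gamma> l k) (fst (p 0) $ l) * fst w $ l))))
     (at 0 within {0..\<delta>})"
  proof (rule DERIV_sum)
    fix l assume "l \<in> UNIV - {k}"
    then have "k \<noteq> l" "l \<noteq> k" by auto
    from DERIV_mult[OF DERIV_mult[OF G payoffs(2)[OF this(1)]] payoffs(1)[OF this(2)], of l]
    show "((\<lambda>t. link_strength (snd (p t)) k l * deriv_nn (payoff \<Gamma> k l) (fst (p t) $ k) *
         payoff \<Gamma> l k (fst (p t) $ l)) has_real_derivative
         link_strength (snd w) k l * deriv_nn (payoff \<Gamma> k l) (fst (p 0) $ k) * payoff \<Gamma> l k (fst (p 0) $ l)
         + link_strength (snd (p 0)) k l *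
           (deriv_nn (deriv_nn (payoff \<Gamma> k l)) (fst (p 0) $ k) * fst w $ k * payoff \<Gamma> l k (fst (p 0) $ l)
            + deriv_nn (payoff \<Gamma> k l) (fst (p 0) $ k) * (deriv_nn (payoff \<Gamma> l k) (fst (p 0) $ l) * fst w $ l)))
     (at 0 within {0..\<delta>})"
      by (simp add: algebra_simps)
  qed
  from DERIV_diff[OF DERIV_diff[OF C DERIV_const] DERIV_cmult[OF this]]
  show "((\<lambda>t. implied_action_subsidy \<Gamma> k (p t)) has_real_derivative
      implied_action_subsidy_deriv \<Gamma> k (p 0) w) (at_right 0)"
    by (simp add: at_0 implied_action_subsidy_def implied_action_subsidy_deriv_def case_prod_unfold)
  have *: "fst (x + t *\<^sub>R v) $ k = implied_action_subsidy \<Gamma> k (p t)" if "t \<in> {0..\<delta>}" for t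
  proof -
    have "x + t *\<^sub>R v \<in> subsidies"
      using that x v by (simp add: add_scaleR_nonneg_pairs)
    then show ?thesis
      using nash_action(2)[OF valid, of "fst (x + t *\<^sub>R v)" "snd (x + t *\<^sub>R v)" "fst (p t)" "snd (p t)" k,
          unfolded prod.collapse, OF nash[OF that]]
      by (simp add: nonneg_pairs_def case_prod_unfold)
  qed
  show "\<forall>\<^sub>F t in at_right 0. fst (x + t *\<^sub>R v) $ k = implied_action_subsidy \<Gamma> k (p t)"
    using eventually_in by (rule eventually_mono) (rule *)
  show "fst (x + 0 *\<^sub>R v) $ k = implied_action_subsidy \<Gamma> k (p 0)"
    using *[of 0] \<delta> by simp
qed

lemma no_self_link_direction: "snd w $ k $ k = 0"
proof (rule right_derivative_unique)
  show "((\<lambda>t. snd (p t) $ k $ k) has_real_derivative snd w $ k $ k) (at_right 0)"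
    using link_deriv by (simp add: at_0)
  have *: "snd (p t) $ k $ k = 0" if "t \<in> {0..\<delta>}" for t
    using p_profile[OF that] by (auto simp: nonneg_pairs_def)
  show "\<forall>\<^sub>F t in at_right 0. snd (p t) $ k $ k = 0"
    using eventually_in by (rule eventually_mono) (rule *)
  show "snd (p 0) $ k $ k = 0" using * \<delta> by simp
qed simp

text \<open>Here \<open>h\<close> is the subsidized marginal return of the link at the start and
  \<open>h'\<close> its rate of change. A positive link stays positive by continuity and keeps the
  equality; at \<open>h = 0\<close> the \<open>max\<close> form has slope \<open>max 0 h'\<close>;
  where the return is negative for small \<open>t > 0\<close>, the link is zero there.\<close>

lemma link_subsidy_direction:
  assumes kl: "k \<noteq> l"
  defines "h \<equiv> link_return \<Gamma> k l (fst (p 0)) + snd x $ k $ l"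
    and "h' \<equiv> link_return_deriv \<Gamma> k l (fst (p 0)) (fst w) + snd v $ k $ l"
    and "F'' \<equiv> deriv_nn (deriv_nn (link_cost \<Gamma> k l)) (snd (p 0) $ k $ l)"
  shows "0 < snd (p 0) $ k $ l \<Longrightarrow> F'' * snd w $ k $ l = h'"
    and "0 \<le> h \<Longrightarrow> 0 \<le> h' \<Longrightarrow> F'' * snd w $ k $ l = h'"
    and "h < 0 \<Longrightarrow> snd w $ k $ l = 0"
    and "h \<le> 0 \<Longrightarrow> h' < 0 \<Longrightarrow> snd w $ k $ l = 0"
proof -
  let ?F' = "\<lambda>t. deriv_nn (link_cost \<Gamma> k l) (snd (p t) $ k $ l)"
  let ?h = "\<lambda>t. link_return \<Gamma> k l (fst (p t)) + snd (x + t *\<^sub>R v) $ k $ l"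
  have h0: "?h 0 = h" by (simp add: h_def)
  have F': "(?F' has_real_derivative F'' * snd w $ k $ l) (at_right 0)"
    unfolding F''_def at_0[symmetric]
    by (rule deriv_nn_chain[OF _ link_deriv p_nonneg(2)])
      (use valid kl \<delta> in \<open>auto simp: valid_game_def cost_functionD\<close>)
  have "((\<lambda>t. synergy \<Gamma> * (payoff \<Gamma> k l (fst (p t) $ k) * payoff \<Gamma> l k (fst (p t) $ l)) + link_value \<Gamma> k l +
      (snd x $ k $ l + t * snd v $ k $ l)) has_real_derivative h') (at 0 within {0..\<delta>})"
    by (rule derivative_eq_intros payoffs kl kl[symmetric] refl)+
      (simp add: h'_def link_return_deriv_def algebra_simps)
  then have h: "(?h has_real_derivative h') (at_right 0)"
    by (simp add: at_0 link_return_def)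
  have foc: "?F' t = max 0 (?h t)" "?h t < 0 \<Longrightarrow> snd (p t) $ k $ l = 0"
    "0 < snd (p t) $ k $ l \<Longrightarrow> ?F' t = ?h t" if "t \<in> {0..\<delta>}" for t
    using nash_link[OF valid, of "fst (x + t *\<^sub>R v)" "snd (x + t *\<^sub>R v)" "fst (p t)" "snd (p t)" k l,
        unfolded prod.collapse, OF nash[OF that] kl] by auto
  have max0: "F'' * snd w $ k $ l = max 0 h'" if "h = 0"
  proof (rule right_derivative_unique[OF F' right_derivative_max_0[OF h]])
    show "?h 0 = 0" using that h0 by simp
    show "\<forall>\<^sub>F t in at_right 0. ?F' t = max 0 (?h t)"
      using eventually_in by (rule eventually_mono) (rule foc(1))
    show "?F' 0 = max 0 (?h 0)" using foc(1) \<delta> by simp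
  qed
  show pos: "F'' * snd w $ k $ l = h'" if "0 < snd (p 0) $ k $ l"
  proof (rule right_derivative_unique[OF F' h])
    have "continuous (at_right 0) (\<lambda>t. snd (p t) $ k $ l)"
      using link_deriv unfolding at_0 by (rule DERIV_continuous)
    then have "((\<lambda>t. snd (p t) $ k $ l) \<longlongrightarrow> snd (p 0) $ k $ l) (at_right 0)"
      by (simp add: continuous_within)
    from order_tendstoD(1)[OF this that]
    show "\<forall>\<^sub>F t in at_right 0. ?F' t = ?h t"
      using eventually_in by eventually_elim (rule foc(3))
    show "?F' 0 = ?h 0" using foc(3) that \<delta> by simp
  qed
  \<comment> \<open>Marginal cost vanishes at a zero link. Hence \<open>0 \<le> h\<close> leaves
    only a positive link or \<open>h = 0\<close>.\<close>
  have "snd (p 0) $ k $ l = 0 \<Longrightarrow> h \<le> 0"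
    using foc(1)[of 0] h0 \<delta> valid kl by (auto simp: valid_game_def cost_functionD)
  then show "F'' * snd w $ k $ l = h'" if "0 \<le> h" "0 \<le> h'"
    using pos max0 that p_nonneg(2)[of 0 k l] \<delta> by fastforce
  have zero: "snd w $ k $ l = 0" if "h \<le> 0" "h = 0 \<Longrightarrow> h' < 0" "snd (p 0) $ k $ l = 0"
  proof (rule right_derivative_unique)
    show "((\<lambda>t. snd (p t) $ k $ l) has_real_derivative snd w $ k $ l) (at_right 0)"
      using link_deriv by (simp add: at_0)
    have "\<forall>\<^sub>F t in at_right 0. ?h t < 0"
      by (rule right_derivative_neg_eventually[OF h]) (use that h0 in auto)
    then show "\<forall>\<^sub>F t in at_right 0. snd (p t) $ k $ l = 0"
      using eventually_in by eventually_elim (rule foc(2))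
  qed (use that in auto)
  show neg: "h < 0 \<Longrightarrow> snd w $ k $ l = 0"
    using zero foc(2)[of 0] h0 \<delta> by auto
  show "snd w $ k $ l = 0" if "h \<le> 0" "h' < 0"
  proof (cases "snd (p 0) $ k $ l = 0")
    case False
    then have g: "0 < snd (p 0) $ k $ l" using p_nonneg(2)[of 0 k l] \<delta> by simp
    \<comment> \<open>If \<open>h = 0\<close>, the two formulas for the same product would give
      \<open>max 0 h' = h'\<close> with \<open>h' < 0\<close>, which is absurd; if
      \<open>h < 0\<close>, \<open>neg\<close> applies.\<close>
    show ?thesis
      using max0 pos[OF g] neg that by force
  qed (use zero that in auto)
qed

lemma lagrangian_deriv:
  assumes W: "(W has_derivative W') (at (fst (p 0)) within {a. \<forall>k. 0 \<le> a $ k})"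
  shows "((\<lambda>t. W (fst (p t)) - c * planner_payment (x + t *\<^sub>R v) (p t)) has_real_derivative
    W' (fst w) - c * (planner_payment v (p 0) + planner_payment x w)) (at_right 0)"
proof -
  have f: "((\<lambda>t. fst (p t)) has_vector_derivative fst w) (at 0 within {0..\<delta>})"
    by (rule bounded_linear.has_vector_derivative[OF bounded_linear_fst p])
  have "(W has_derivative W') (at (fst (p 0)) within (\<lambda>t. fst (p t)) ` {0..\<delta>})"
    by (rule has_derivative_subset[OF W]) (use p_nonneg in auto)
  from vector_derivative_diff_chain_within[OF f this]
  have W1: "((\<lambda>t. W (fst (p t))) has_real_derivative W' (fst w)) (at 0 within {0..\<delta>})"
    by (simp add: o_def has_real_derivative_iff_has_vector_derivative)
  have "((\<lambda>t. x + t *\<^sub>R v) has_vector_derivative v) (at 0 within {0..\<delta>})"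
    by (auto intro!: derivative_eq_intros)
  from bounded_bilinear.has_vector_derivative[OF bounded_bilinear_planner_payment this p]
  have "((\<lambda>t. planner_payment (x + t *\<^sub>R v) (p t)) has_real_derivative
      planner_payment v (p 0) + planner_payment x w) (at 0 within {0..\<delta>})"
    by (simp add: has_real_derivative_iff_has_vector_derivative add.commute)
  from DERIV_diff[OF W1 DERIV_cmult[OF this]] show ?thesis
    by (simp add: at_0)
qed

end

section \<open>Equilibrium responses\<close>

text \<open>The selection is differentiable only relative to the subsidies. Its derivative
  \<open>D\<close> is linear on the whole space but tied to equilibria only along feasible rays,
  which never touch the diagonal.\<close>

lemma differentiable_selection_paths:
  fixes \<Gamma> :: "'n::finite network_game"
  assumes valid: "valid_game \<Gamma>" and sel: "equilibrium_selection \<Gamma> eq"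
    and diff: "selection_differentiable_near \<Gamma> eq x" and x: "x \<in> subsidies"
  obtains D where "linear D"
    "\<And>v. v \<in> nonneg_pairs \<Longrightarrow> \<exists>\<delta>. equilibrium_path \<Gamma> x v (D v) (\<lambda>t. eq (x + t *\<^sub>R v)) \<delta>"
proof -
  obtain N where N: "open N" "x \<in> N" "\<And>y. y \<in> N \<inter> subsidies \<Longrightarrow> has_equilibrium \<Gamma> y"
    and d: "eq differentiable_on (N \<inter> subsidies)"
    using diff unfolding selection_differentiable_near_def by blast
  obtain D where D: "(eq has_derivative D) (at x within N \<inter> subsidies)"
    using d x N(2) unfolding differentiable_on_def differentiable_def by blast
  show ?thesis
  proof (rule that)
    show "linear D" using D by (rule has_derivative_linear)
    fix v :: "(real^'n) \<times> (real^'n^'n)" assume v: "v \<in> nonneg_pairs"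
    have "open ((\<lambda>t. x + t *\<^sub>R v) -` N)"
      using N(1) by (intro continuous_open_vimage) (auto intro!: continuous_intros)
    moreover have "0 \<in> (\<lambda>t. x + t *\<^sub>R v) -` N" using N(2) by simp
    ultimately obtain \<delta> where \<delta>: "0 < \<delta>" "cball 0 \<delta> \<subseteq> (\<lambda>t. x + t *\<^sub>R v) -` N"
      using open_contains_cball by blast
    have mem: "x + t *\<^sub>R v \<in> N \<inter> subsidies" if "t \<in> {0..\<delta>}" for t
      using that \<delta>(2) add_scaleR_nonneg_pairs[OF x v] by (auto simp: subset_iff)
    have line: "((\<lambda>t. x + t *\<^sub>R v) has_vector_derivative v) (at 0 within {0..\<delta>})"
      by (auto intro!: derivative_eq_intros)
    have "(eq has_derivative D) (at (x + 0 *\<^sub>R v) within (\<lambda>t. x + t *\<^sub>R v) ` {0..\<delta>})"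
      by (simp, rule has_derivative_subset[OF D]) (use mem in blast)
    from vector_derivative_diff_chain_within[OF line this]
    have "((\<lambda>t. eq (x + t *\<^sub>R v)) has_vector_derivative D v) (at 0 within {0..\<delta>})"
      by (simp add: o_def)
    then have "equilibrium_path \<Gamma> x v (D v) (\<lambda>t. eq (x + t *\<^sub>R v)) \<delta>"
      using \<delta>(1) valid x v mem N(3) sel
      by unfold_locales (auto simp: equilibrium_selection_def)
    then show "\<exists>\<delta>. equilibrium_path \<Gamma> x v (D v) (\<lambda>t. eq (x + t *\<^sub>R v)) \<delta>" ..
  qed
qed

text \<open>Nonnegative pairs span the pairs with zero diagonal: \<open>pos 1\<close> and
  \<open>pos (-1)\<close> are the positive and negative parts of \<open>v\<close>.\<close>

lemma linear_eq_on_nonneg_pairs: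
  assumes "linear f" "linear h" and "\<And>v. v \<in> nonneg_pairs \<Longrightarrow> f v = h v"
    and "\<And>k. snd v $ k $ k = 0"
  shows "f v = h v"
proof -
  define pos where "pos c = ((\<chi> k. max 0 (c * fst v $ k)), (\<chi> k l. max 0 (c * snd v $ k $ l)))" for c
  have Q: "pos c \<in> nonneg_pairs" for c
    using assms(4) by (simp add: pos_def nonneg_pairs_def)
  have "v = pos 1 - pos (-1)"
    by (simp add: pos_def prod_eq_iff vec_eq_iff max_def)
  then show ?thesis
    using assms(3)[OF Q] linear_diff[OF assms(1)] linear_diff[OF assms(2)] by metis
qed

text \<open>An injective linear map preserves dimension, and a subspace of \<open>S\<close> with the
  dimension of \<open>S\<close> is all of \<open>S\<close>.\<close>

lemma linear_inj_subspace_surj: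
  fixes D :: "'a::euclidean_space \<Rightarrow> 'a"
  assumes D: "linear D" and S: "subspace S" "D ` S \<subseteq> S"
    and inj: "\<And>v. v \<in> S \<Longrightarrow> D v = 0 \<Longrightarrow> v = 0"
  shows "D ` S = S"
proof (rule subspace_dim_equal)
  have "inj_on D (span S)"
  proof (rule inj_onI)
    fix v w assume "v \<in> span S" "w \<in> span S" "D v = D w"
    then have "v - w \<in> S" "D (v - w) = 0"
      using S(1) linear_diff[OF D] by (auto simp: span_eq_iff[THEN iffD2] subspace_diff)
    then show "v = w" using inj by force
  qed
  then show "dim S \<le> dim (D ` S)"
    using dim_image_eq[OF D] by simp
qed (use S D in \<open>auto intro: linear_subspace_image\<close>)

text \<open>Turns the partial derivatives in the Karush-Kuhn-Tucker conditions, taken at the current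
  subsidy, into right derivatives at \<open>0\<close> along a ray, whether or not that subsidy is
  zero.\<close>

lemma shift_right_derivative:
  fixes f :: "real \<Rightarrow> real"
  assumes "(f has_real_derivative d) (at c within {0..})" "0 \<le> c"
  shows "((\<lambda>t. f (c + t)) has_real_derivative d) (at_right 0)"
proof -
  have "(f has_real_derivative d) (at (c + 0) within (+) c ` {0<..})"
    by (simp, rule has_field_derivative_subset[OF assms(1)]) (use assms(2) in auto)
  moreover have "((+) c has_real_derivative 1) (at_right 0)"
    by (auto intro!: derivative_eq_intros)
  ultimately show ?thesis
    using DERIV_image_chain[of f d "(+) c" 0 "{0<..}" 1] by (simp add: o_def)
qed

lemma axis_subsidies:
  "(axis k 1, 0) \<in> nonneg_pairs" "k \<noteq> l \<Longrightarrow> (0, axis k (axis l 1)) \<in> nonneg_pairs"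
  by (auto simp: nonneg_pairs_def axis_def)

lemma planner_payment_axis:
  "planner_payment (axis k 1, 0) p = fst p $ k"
  "k \<noteq> l \<Longrightarrow> planner_payment (0, axis k (axis l 1)) p = link_strength (snd p) k l"
proof -
  have "subsidy_receipt (axis k 1, 0) m p = (if m = k then fst p $ k else 0)" for m
    by (simp add: subsidy_receipt_def case_prod_unfold axis_def)
  then show "planner_payment (axis k 1, 0) p = fst p $ k"
    by (simp add: planner_payment_def)
  assume "k \<noteq> l"
  have "(axis l 1 :: real^'a) $ n * c = (if n = l then c else 0)" for n c
    by (simp add: axis_def)
  then have "subsidy_receipt (0, axis k (axis l 1)) m p = (if m = k then link_strength (snd p) k l else 0)" for m
    using \<open>k \<noteq> l\<close> by (simp add: subsidy_receipt_def case_prod_unfold axis_def[of k])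
  then show "planner_payment (0, axis k (axis l 1)) p = link_strength (snd p) k l"
    by (simp add: planner_payment_def)
qed

lemma negative_perturbation:
  fixes r s :: real
  assumes "r < 0"
  obtains \<epsilon> where "0 < \<epsilon>" "r + \<epsilon> * s < 0"
proof
  \<comment> \<open>With \<open>\<epsilon> = - r / (2 * ?c)\<close> the term
    \<open>\<epsilon> * s\<close> is at most \<open>- r / 2\<close>; adding \<open>1\<close> keeps
    the denominator positive when \<open>s = 0\<close>.\<close>
  let ?c = "\<bar>s\<bar> + 1"
  have half: "- r / (2 * c) * c = - r / 2" if "0 < c" for c
    using that by simp
  have "- r / (2 * ?c) * s \<le> - r / (2 * ?c) * ?c"
    using assms by (intro mult_left_mono divide_nonneg_pos) auto
  also have "\<dots> = - r / 2" by (rule half) auto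
  finally show "r + - r / (2 * ?c) * s < 0" using assms by linarith
  show "0 < - r / (2 * ?c)" using assms by (intro divide_pos_pos) auto
qed

text \<open>Link costs are symmetric in the two agents only on the nonnegative reals; this carries
  the symmetry over to their derivatives.\<close>

lemma deriv_nn_cong:
  assumes "\<And>y. 0 \<le> y \<Longrightarrow> f y = h y" "0 \<le> x"
  shows "deriv_nn f x = deriv_nn h x"
proof -
  have "(f has_vector_derivative d) (at x within {0..}) \<longleftrightarrow> (h has_vector_derivative d) (at x within {0..})" for d
    using assms has_vector_derivative_transform[of x "{0..}" f h d]
      has_vector_derivative_transform[of x "{0..}" h f d] by auto
  then show ?thesis by (simp add: deriv_nn_def vector_derivative_def)
qed

theorem proposition4:
  fixes \<Gamma> :: "'n::finite network_game"
    and W :: "real^'n \<Rightarrow> real"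
    and B :: real
    and eq :: "(real^'n) \<times> (real^'n^'n) \<Rightarrow> (real^'n) \<times> (real^'n^'n)"
    and \<beta> :: "real^'n" and \<sigma> :: "real^'n^'n"
    and i j :: 'n
  assumes "valid_game \<Gamma>"
    and "planner_objective W"
    and "B > 0"
    and "equilibrium_selection \<Gamma> eq"
    and "optimal_subsidy \<Gamma> W B eq (\<beta>, \<sigma>)"
    and "selection_differentiable_near \<Gamma> eq (\<beta>, \<sigma>)"
    and "budget_strictly_binds W B eq (\<beta>, \<sigma>)"
    and "i \<noteq> j"
    and "link_value \<Gamma> i j < 0"
    and "sub_quadratic (link_cost \<Gamma> i j)"
    and "super_linear (payoff \<Gamma> i j)" and "super_linear (payoff \<Gamma> j i)"
    and "\<beta> $ i > 0" and "\<beta> $ j > 0"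
    and "snd (eq (\<beta>, \<sigma>)) $ i $ j > 0" and "snd (eq (\<beta>, \<sigma>)) $ j $ i > 0"
  shows "\<sigma> $ i $ j + \<sigma> $ j $ i > 0"
proof (rule ccontr)
  assume not_pos: "\<not> \<sigma> $ i $ j + \<sigma> $ j $ i > 0"
  note valid = assms(1) and ij = \<open>i \<noteq> j\<close>
  define x where "x = (\<beta>, \<sigma>)"
  define a where "a = fst (eq x)"
  define g where "g = snd (eq x)"
  have x: "x \<in> subsidies"
    using assms(5) by (simp add: optimal_subsidy_def x_def)
  then have x_nonneg: "0 \<le> \<beta> $ k" "0 \<le> \<sigma> $ k $ l" for k l
    by (auto simp: x_def nonneg_pairs_def)
  then have \<sigma>0: "\<sigma> $ i $ j = 0" "\<sigma> $ j $ i = 0"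
    using not_pos by (smt (verit))+
  have g_pos: "0 < g $ i $ j" "0 < g $ j $ i"
    using assms(15,16) by (simp_all add: g_def x_def)
  have nash: "nash_equilibrium \<Gamma> (\<beta>, \<sigma>) (a, g)"
    using assms(4,5) x by (simp add: optimal_subsidy_def equilibrium_selection_def x_def a_def g_def)
  then have prof: "(a, g) \<in> profiles" by (simp add: nash_equilibrium_def)
  then have a_nonneg: "0 \<le> a $ k" for k by (simp add: nonneg_pairs_def)

  \<comment> \<open>The equilibrium response as a linear bijection\<close>
  obtain D where D: "linear D"
    and path: "\<And>v. v \<in> nonneg_pairs \<Longrightarrow> \<exists>\<delta>. equilibrium_path \<Gamma> x v (D v) (\<lambda>t. eq (x + t *\<^sub>R v)) \<delta>"
    using differentiable_selection_paths[OF valid assms(4) _ x] assms(6) unfolding x_def by metis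

  \<comment> \<open>The first-order condition of the link as an equality, linearised in direction
    \<open>v\<close>.\<close>
  define lin where "lin k l v \<longleftrightarrow>
    deriv_nn (deriv_nn (link_cost \<Gamma> k l)) (g $ k $ l) * snd (D v) $ k $ l =
    link_return_deriv \<Gamma> k l a (fst (D v)) + snd v $ k $ l" for k l v
  \<comment> \<open>\<open>E\<close> collects the links of the first kind in the dichotomy.\<close>
  define E where "E = {(k, l). k \<noteq> l \<and> (\<forall>v\<in>nonneg_pairs. lin k l v)}"
  \<comment> \<open>\<open>S\<close> serves both as a space of subsidy changes and as a space of
    responses. Its action coordinates are unrestricted.\<close>
  define S :: "((real^'n) \<times> (real^'n^'n)) set"
    where "S = {v. \<forall>k l. (k, l) \<notin> E \<longrightarrow> snd v $ k $ l = 0}"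
  have diag: "snd v $ k $ k = 0" if "v \<in> S" for v k
    using that by (simp add: S_def E_def)
  have S: "subspace S"
    unfolding subspace_def S_def by simp

  \<comment> \<open>One direction \<open>v1\<close> violating \<open>lin\<close> forces a zero link
    with nonpositive return. If the return is negative, the link does not respond at all; if it is
    zero, the response vanishes along \<open>v1\<close> and a small perturbation of it, hence along
    \<open>v\<close> by linearity of \<open>D\<close>.\<close>
  have not_E: "snd (D v) $ k $ l = 0" if v: "v \<in> nonneg_pairs" and kl: "(k, l) \<notin> E" for v k l
  proof (cases "k = l")
    case True
    then show ?thesis using path[OF v] equilibrium_path.no_self_link_direction by blast
  next
    case False
    let ?h = "link_return \<Gamma> k l a + \<sigma> $ k $ l"
    let ?h' = "\<lambda>v. link_return_deriv \<Gamma> k l a (fst (D v)) + snd v $ k $ l"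
    have dir: "0 \<le> ?h \<Longrightarrow> 0 \<le> ?h' v \<Longrightarrow> lin k l v"
      "?h < 0 \<Longrightarrow> snd (D v) $ k $ l = 0"
      "?h \<le> 0 \<Longrightarrow> ?h' v < 0 \<Longrightarrow> snd (D v) $ k $ l = 0" "0 < g $ k $ l \<Longrightarrow> lin k l v"
      if "v \<in> nonneg_pairs" for v
    proof -
      obtain \<delta> where "equilibrium_path \<Gamma> x v (D v) (\<lambda>t. eq (x + t *\<^sub>R v)) \<delta>"
        using path \<open>v \<in> nonneg_pairs\<close> by blast
      from equilibrium_path.link_subsidy_direction[OF this False]
      show "0 \<le> ?h \<Longrightarrow> 0 \<le> ?h' v \<Longrightarrow> lin k l v"
      "?h < 0 \<Longrightarrow> snd (D v) $ k $ l = 0"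
      "?h \<le> 0 \<Longrightarrow> ?h' v < 0 \<Longrightarrow> snd (D v) $ k $ l = 0" "0 < g $ k $ l \<Longrightarrow> lin k l v"
        by (simp_all add: lin_def a_def g_def x_def)
    qed
    obtain v1 where v1: "v1 \<in> nonneg_pairs" "\<not> lin k l v1"
      using kl False by (auto simp: E_def)
    have "g $ k $ l = 0"
      using dir(4)[OF v1(1)] v1(2) prof by (force simp: nonneg_pairs_def less_eq_real_def)
    then have h: "?h \<le> 0"
      using nash_link(1)[OF valid nash False] valid False
      by (auto simp: valid_game_def cost_functionD)
    show ?thesis
    proof (cases "?h < 0")
      case True
      then show ?thesis using dir(2) v by blast
    next
      case False
      then have h'1: "?h' v1 < 0" using dir(1)[OF v1(1)] v1(2) by force
      \<comment> \<open>Along \<open>v1\<close>, and hence also along \<open>v1 + \<epsilon> v\<close>, the marginal return of the link becomes negative.\<close>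
      then obtain \<epsilon> where \<epsilon>: "0 < \<epsilon>" "?h' v1 + \<epsilon> * ?h' v < 0"
        by (rule negative_perturbation)
      have "?h' (v1 + \<epsilon> *\<^sub>R v) = ?h' v1 + \<epsilon> * ?h' v"
        by (simp add: linear_add[OF D] linear_scale[OF D] linear_add[OF linear_link_return_deriv]
            linear_scale[OF linear_link_return_deriv] algebra_simps)
      with \<epsilon>(2) have "snd (D (v1 + \<epsilon> *\<^sub>R v)) $ k $ l = 0"
        using dir(3) h v1(1) v \<epsilon> by (simp add: add_scaleR_nonneg_pairs)
      moreover have "snd (D v1) $ k $ l = 0" using dir(3) h v1(1) h'1 by blast
      ultimately show ?thesis using \<epsilon> by (simp add: linear_add[OF D] linear_scale[OF D])
    qed
  qed

  \<comment> \<open>The paths give this for nonnegative directions; linearity extends it to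
    \<open>S\<close>, whose members have zero diagonal. The same extension yields
    \<open>link\<close> on \<open>E\<close>.\<close>
  have act: "fst v $ k = implied_action_subsidy_deriv \<Gamma> k (a, g) (D v)" if "v \<in> S" for v k
  proof (rule linear_eq_on_nonneg_pairs[where v = v])
    show "linear (\<lambda>v. implied_action_subsidy_deriv \<Gamma> k (a, g) (D v))"
      using linear_compose[OF D linear_implied_action_subsidy_deriv] by (simp add: o_def)
    show "fst v $ k = implied_action_subsidy_deriv \<Gamma> k (a, g) (D v)" if "v \<in> nonneg_pairs" for v
      using path[OF that] equilibrium_path.action_subsidy_direction[of \<Gamma> x v "D v" "\<lambda>t. eq (x + t *\<^sub>R v)"]
      by (auto simp: a_def g_def)
  qed (auto intro!: linearI simp: diag that)
  have link: "snd v $ k $ l = deriv_nn (deriv_nn (link_cost \<Gamma> k l)) (g $ k $ l) * snd (D v) $ k $ l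
      - link_return_deriv \<Gamma> k l a (fst (D v))" if "v \<in> S" "(k, l) \<in> E" for v k l
  proof (rule linear_eq_on_nonneg_pairs[where v = v])
    show "linear (\<lambda>v. deriv_nn (deriv_nn (link_cost \<Gamma> k l)) (g $ k $ l) * snd (D v) $ k $ l
      - link_return_deriv \<Gamma> k l a (fst (D v)))"
      by (rule linearI) (simp_all add: linear_add[OF D] linear_scale[OF D]
          linear_add[OF linear_link_return_deriv] linear_scale[OF linear_link_return_deriv] algebra_simps)
    show "snd v $ k $ l = deriv_nn (deriv_nn (link_cost \<Gamma> k l)) (g $ k $ l) * snd (D v) $ k $ l
      - link_return_deriv \<Gamma> k l a (fst (D v))" if "v \<in> nonneg_pairs" for v
      using that \<open>(k, l) \<in> E\<close> by (auto simp: E_def lin_def)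
  qed (auto intro!: linearI simp: diag that)

  have "D ` S = S"
  proof (rule linear_inj_subspace_surj[OF D S])
    have "snd (D v) $ k $ l = 0" if "v \<in> S" "(k, l) \<notin> E" for v k l
    proof (rule linear_eq_on_nonneg_pairs[where v = v])
      show "linear (\<lambda>v. snd (D v) $ k $ l)"
        by (rule linearI) (simp_all add: linear_add[OF D] linear_scale[OF D])
    qed (use not_E that diag in \<open>auto intro!: linearI\<close>)
    then show "D ` S \<subseteq> S" by (auto simp: S_def)
    \<comment> \<open>\<open>act\<close> and \<open>link\<close> express the action coordinates of
      \<open>v\<close> and those on \<open>E\<close> through \<open>D v\<close>; the remaining ones
      vanish by definition of \<open>S\<close>.\<close>
    fix v assume v: "v \<in> S" "D v = 0"
    have "snd v $ k $ l = 0" for k l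
      using v link[OF v(1), of k l] linear_0[OF linear_link_return_deriv]
      by (cases "(k, l) \<in> E") (auto simp: S_def)
    moreover have "fst v $ k = 0" for k
      using act[OF v(1), of k] v(2) linear_0[OF linear_implied_action_subsidy_deriv] by simp
    ultimately show "v = 0" by (simp add: prod_eq_iff vec_eq_iff)
  qed

  \<comment> \<open>The subsidy change that scales up the two links\<close>
  define w :: "(real^'n) \<times> (real^'n^'n)"
    where "w = (0, axis i (axis j (g $ i $ j)) + axis j (axis i (g $ j $ i)))"
  have w_nth: "snd w $ k $ l = (if k = i \<and> l = j \<or> k = j \<and> l = i then g $ k $ l else 0)" for k l
    using ij by (auto simp: w_def axis_def)
  have E: "(i, j) \<in> E" "(j, i) \<in> E"
  proof -
    have "lin k l v" if "v \<in> nonneg_pairs" "k \<noteq> l" "0 < g $ k $ l" for v k l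
      using path[OF that(1)] equilibrium_path.link_subsidy_direction(1)[of \<Gamma> x v "D v" "\<lambda>t. eq (x + t *\<^sub>R v)" _ k l]
        that by (auto simp: lin_def a_def g_def)
    then show "(i, j) \<in> E" "(j, i) \<in> E" using ij g_pos by (auto simp: E_def)
  qed
  then have "w \<in> S" by (auto simp: S_def w_nth)
  then have "w \<in> D ` S" by (simp add: \<open>D ` S = S\<close>)
  then obtain v where v: "v \<in> S" "D v = w" by (metis imageE)

  let ?G = "link_strength g i j"
  define F'' where "F'' k l = deriv_nn (deriv_nn (link_cost \<Gamma> k l)) (g $ k $ l)" for k l
  have fst_w: "fst w = 0" by (simp add: w_def)
  \<comment> \<open>Actions do not respond, so link returns stay constant and the link subsidies
    only have to match the rise in marginal link costs.\<close>
  have v_link: "snd v $ k $ l = (if k = i \<and> l = j \<or> k = j \<and> l = i then F'' k l * g $ k $ l else 0)" for k l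
  proof (cases "(k, l) \<in> E")
    case True
    have "snd v $ k $ l = F'' k l * snd w $ k $ l"
      using link[OF v(1) True] by (simp add: v(2) fst_w F''_def linear_0[OF linear_link_return_deriv])
    then show ?thesis by (simp add: w_nth)
  next
    case False
    then have "snd v $ k $ l = 0" using v(1) by (simp add: S_def)
    then show ?thesis using False E by auto
  qed
  have w_G: "link_strength (snd w) k l = (if k = i \<and> l = j \<or> k = j \<and> l = i then ?G else 0)" for k l
    using ij by (auto simp: link_strength_def w_nth)
  have v_act: "fst v $ k = - synergy \<Gamma> * (\<Sum>l\<in>UNIV - {k}.
      link_strength (snd w) k l * deriv_nn (payoff \<Gamma> k l) (a $ k) * payoff \<Gamma> l k (a $ l))" for k
    using act[OF v(1), of k] v(2) by (simp add: implied_action_subsidy_deriv_def case_prod_unfold fst_w)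
  have v_i: "fst v $ i = - synergy \<Gamma> * (?G * deriv_nn (payoff \<Gamma> i j) (a $ i) * payoff \<Gamma> j i (a $ j))"
    unfolding v_act using ij
    by (simp add: w_G if_distrib[of "\<lambda>x. x * _"] sum.delta cong: if_cong)
  have v_j: "fst v $ j = - synergy \<Gamma> * (?G * deriv_nn (payoff \<Gamma> j i) (a $ j) * payoff \<Gamma> i j (a $ i))"
    unfolding v_act using ij
    by (simp add: w_G if_distrib[of "\<lambda>x. x * _"] sum.delta cong: if_cong)
  have v_0: "fst v $ k = 0" if "k \<noteq> i" "k \<noteq> j" for k
    unfolding v_act using that by (simp add: w_G)
  let ?e = "\<lambda>k. (axis k 1, 0) :: (real^'n) \<times> (real^'n^'n)"
  let ?f = "\<lambda>k l. (0, axis k (axis l 1)) :: (real^'n) \<times> (real^'n^'n)"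
  \<comment> \<open>The action coordinates of \<open>v\<close> are nonpositive, so \<open>v\<close>
    itself need not be a nonnegative direction. Each of the four axis directions is one, and there
    the Karush-Kuhn-Tucker conditions apply.\<close>
  have v_eq: "v = (fst v $ i) *\<^sub>R ?e i + (fst v $ j) *\<^sub>R ?e j
      + (snd v $ i $ j) *\<^sub>R ?f i j + (snd v $ j $ i) *\<^sub>R ?f j i"
    using ij v_0 by (auto simp: prod_eq_iff vec_eq_iff axis_def v_link)

  \<comment> \<open>The linearised Lagrangian and the Karush-Kuhn-Tucker conditions\<close>
  obtain W' where W: "(W has_derivative W') (at a within {a. \<forall>k. 0 \<le> a $ k})"
    using assms(2) a_nonneg unfolding planner_objective_def differentiable_on_def differentiable_def by blast
  obtain c where c: "c > 0"
    and kkt_act: "\<And>k. \<exists>d. ((\<lambda>t. lagrangian W eq c (upd \<beta> k t, \<sigma>)) has_real_derivative d)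
             (at (\<beta> $ k) within {0..}) \<and> d \<le> 0 \<and> (\<beta> $ k > 0 \<longrightarrow> d = 0)"
    and kkt_link: "\<And>k l. k \<noteq> l \<Longrightarrow> \<exists>d.
           ((\<lambda>t. lagrangian W eq c (\<beta>, upd \<sigma> k (upd (\<sigma> $ k) l t))) has_real_derivative d)
             (at (\<sigma> $ k $ l) within {0..}) \<and> d \<le> 0 \<and> (\<sigma> $ k $ l > 0 \<longrightarrow> d = 0)"
    using assms(7) unfolding budget_strictly_binds_def by auto
  \<comment> \<open>The linear extension to all directions of the derivative of the Lagrangian along
    nonnegative rays.\<close>
  define L' where "L' v = W' (fst (D v)) - c * (planner_payment v (a, g) + planner_payment x (D v))" for v
  interpret pay: bounded_bilinear "planner_payment :: (real^'n) \<times> (real^'n^'n) \<Rightarrow> _"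
    by (rule bounded_bilinear_planner_payment)
  have L': "linear L'"
    unfolding L'_def using has_derivative_linear[OF W]
    by (intro linearI) (simp_all add: linear_add linear_scale D pay.add_left pay.add_right
        pay.scaleR_left pay.scaleR_right algebra_simps)
  have L_deriv: "((\<lambda>t. lagrangian W eq c (x + t *\<^sub>R v)) has_real_derivative L' v) (at_right 0)"
    if v: "v \<in> nonneg_pairs" for v
  proof -
    obtain \<delta> where "equilibrium_path \<Gamma> x v (D v) (\<lambda>t. eq (x + t *\<^sub>R v)) \<delta>"
      using path[OF v] by blast
    from equilibrium_path.lagrangian_deriv[OF this, of W W' c] W
    show ?thesis by (simp add: lagrangian_def L'_def a_def g_def)
  qed
  have L'_act: "L' (?e k) = 0" if "0 < \<beta> $ k" for k
  proof -
    have "((\<lambda>t. lagrangian W eq c (upd \<beta> k t, \<sigma>)) has_real_derivative 0) (at (\<beta> $ k) within {0..})"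
      using kkt_act[of k] that by auto
    from shift_right_derivative[OF this x_nonneg(1)]
    have "((\<lambda>t. lagrangian W eq c (upd \<beta> k (\<beta> $ k + t), \<sigma>)) has_real_derivative 0) (at_right 0)" .
    moreover have "(upd \<beta> k (\<beta> $ k + t), \<sigma>) = x + t *\<^sub>R ?e k" for t
      by (auto simp: x_def vec_eq_iff axis_def)
    ultimately show ?thesis
      using right_derivative_unique[OF L_deriv[OF axis_subsidies(1)[of k]]] by force
  qed
  have L'_link: "L' (?f k l) \<le> 0" if "k \<noteq> l" for k l
  proof -
    obtain d where d: "d \<le> 0" and "((\<lambda>t. lagrangian W eq c (\<beta>, upd \<sigma> k (upd (\<sigma> $ k) l t)))
        has_real_derivative d) (at (\<sigma> $ k $ l) within {0..})"
      using kkt_link[OF \<open>k \<noteq> l\<close>] by blast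
    from shift_right_derivative[OF this(2) x_nonneg(2)]
    have "((\<lambda>t. lagrangian W eq c (\<beta>, upd \<sigma> k (upd (\<sigma> $ k) l (\<sigma> $ k $ l + t))))
        has_real_derivative d) (at_right 0)" .
    moreover have "(\<beta>, upd \<sigma> k (upd (\<sigma> $ k) l (\<sigma> $ k $ l + t))) = x + t *\<^sub>R ?f k l" for t
      by (auto simp: x_def vec_eq_iff axis_def)
    ultimately show ?thesis
      using right_derivative_unique[OF L_deriv[OF axis_subsidies(2)[OF that]]] d by force
  qed

  have F: "link_cost \<Gamma> j i y = link_cost \<Gamma> i j y" if "0 \<le> y" for y
    using valid ij that by (auto simp: valid_game_def)
  have F'_eq: "deriv_nn (link_cost \<Gamma> j i) y = deriv_nn (link_cost \<Gamma> i j) y" if "0 \<le> y" for y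
    by (rule deriv_nn_cong[OF F that])
  have F''_eq: "F'' j i = deriv_nn (deriv_nn (link_cost \<Gamma> i j)) (g $ j $ i)"
    unfolding F''_def by (rule deriv_nn_cong[OF F'_eq]) (use g_pos in auto)
  have F''_nonneg: "0 \<le> F'' i j" "0 \<le> F'' j i"
    using valid ij g_pos by (auto simp: F''_def valid_game_def cost_functionD)
  \<comment> \<open>Positive action subsidies make their conditions equalities, so the action terms
    vanish whatever their sign. The link terms are nonnegative multiples of nonpositive
    derivatives.\<close>
  have "L' v = snd v $ i $ j * L' (?f i j) + snd v $ j $ i * L' (?f j i)"
    by (subst v_eq) (simp add: linear_add[OF L'] linear_scale[OF L'] L'_act assms(13,14) del: add_Pair scaleR_Pair)
  also have "\<dots> \<le> 0"
    using L'_link ij F''_nonneg g_pos by (intro add_nonpos_nonpos mult_nonneg_nonpos) (auto simp: v_link)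
  finally have "L' v \<le> 0" .
  \<comment> \<open>Actions stand still and the only moving links carry no subsidy. Welfare and the
    payments for existing subsidies are thus unchanged, and \<open>L' v\<close> is
    \<open>- c\<close> times the cost of the new subsidies.\<close>
  moreover have "planner_payment x w = 0"
    using \<sigma>0 by (auto simp: planner_payment_def subsidy_receipt_def x_def w_G fst_w case_prod_unfold
        intro!: sum.neutral split: if_splits)
  moreover have "W' 0 = 0" using has_derivative_linear[OF W] by (rule linear_0)
  ultimately have pay_nonneg: "0 \<le> planner_payment v (a, g)"
    using c by (simp add: L'_def v(2) fst_w zero_le_mult_iff)

  \<comment> \<open>The sign of the payment change\<close>
  let ?u = "synergy \<Gamma> * (payoff \<Gamma> i j (a $ i) * payoff \<Gamma> j i (a $ j))"
  have pay_v: "planner_payment v (a, g) = fst v $ i * a $ i + fst v $ j * a $ j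
      + (F'' i j * g $ i $ j + F'' j i * g $ j $ i) * ?G"
    using ij by (subst v_eq) (simp add: pay.add_left pay.scaleR_left planner_payment_axis v_link
        link_strength_def algebra_simps del: add_Pair scaleR_Pair)
  \<comment> \<open>Sub-quadraticity bounds the left side by the marginal link cost, which equals
    the return because the link is positive and unsubsidized.\<close>
  have "F'' i j * g $ i $ j \<le> ?u + link_value \<Gamma> i j"
    using nash_link(3)[OF valid nash ij g_pos(1)] assms(10) g_pos \<sigma>0
    by (auto simp: F''_def sub_quadratic_def link_return_def mult.commute dest!: spec[of _ "g $ i $ j"])
  moreover have "F'' j i * g $ j $ i \<le> ?u + link_value \<Gamma> i j"
    using nash_link(3)[OF valid nash ij[symmetric] g_pos(2)] assms(10) g_pos \<sigma>0 valid ij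
    by (auto simp: F''_eq F'_eq sub_quadratic_def link_return_def mult.commute valid_game_def
        dest!: spec[of _ "g $ j $ i"])
  \<comment> \<open>Both link subsidies are paid on the total strength \<open>?G\<close>, not on the
    agent's own intensity.\<close>
  ultimately have "(F'' i j * g $ i $ j + F'' j i * g $ j $ i) * ?G \<le> (2 * ?u + 2 * link_value \<Gamma> i j) * ?G"
    using g_pos by (intro mult_right_mono) (auto simp: link_strength_def)
  moreover have act_le: "fst v $ i * a $ i \<le> - ?u * ?G" "fst v $ j * a $ j \<le> - ?u * ?G"
  proof -
    have "0 \<le> synergy \<Gamma> * ?G * payoff \<Gamma> j i (a $ j)" "0 \<le> synergy \<Gamma> * ?G * payoff \<Gamma> i j (a $ i)"
      using valid ij g_pos a_nonneg by (auto simp: valid_game_def payoff_functionD link_strength_def)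
    moreover have "payoff \<Gamma> i j (a $ i) \<le> a $ i * deriv_nn (payoff \<Gamma> i j) (a $ i)"
      "payoff \<Gamma> j i (a $ j) \<le> a $ j * deriv_nn (payoff \<Gamma> j i) (a $ j)"
      using assms(11,12) a_nonneg by (auto simp: super_linear_def)
    ultimately show "fst v $ i * a $ i \<le> - ?u * ?G" "fst v $ j * a $ j \<le> - ?u * ?G"
      unfolding v_i v_j by (auto dest: mult_left_mono simp: algebra_simps)
  qed
  \<comment> \<open>The two action payments offset the synergy part \<open>2 * ?u * ?G\<close> of
    the link payments; only the negative link value remains.\<close>
  ultimately have "planner_payment v (a, g) \<le> 2 * link_value \<Gamma> i j * ?G"
    unfolding pay_v by (simp add: algebra_simps)
  also have "\<dots> < 0"
    using assms(9) g_pos by (simp add: link_strength_def mult_neg_pos)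
  finally show False using pay_nonneg by simp
qed

end
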